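(* Let $G$ be a finite group which is a Schur cover of some group. Let $V$ be a finite-dimensional complex Hermitian inner product space, $\rho':G\to GL(V)$ an irreducible linear representation of the group $G$ and $\chi$ a character of the quandle $Conj(G)$. Then the quandle representation $\chi\cdot\rho'$ of $Conj(G)$ takes values in the unitary group $U(V)$ if and only if $\rho'$ is unitary (i.e. takes values in $U(V)$) and $\chi$ takes values in the complex numbers of modulus $1$.
   Context: For a group $G$, $Conj(G)$ is the quandle with underlying set $G$ and operation $x\triangleright y=xyx^{-1}$. A finite group $G$ is a Schur cover of a group $H$ if there is a surjective morphism $\theta:G\to H$ such that $\ker(\theta)$ is contained in the center of $G$ and in the derived subgroup of $G$, and $\ker(\theta)\simeq H^2(H,\mathbb{C}^\times)$ (group cohomology with trivial action on $\mathbb{C}^\times$). A quandle representation of a quandle $Q$ on $V$ is a map $\rho:Q\to GL(V)$ with $\rho(x\triangleright y)=\rho(x)\rho(y)\rho(x)^{-1}$. A character of $Q$ is a map $\chi:Q\to\mathbb{C}^\times$ with $\chi(x\triangleright y)=\chi(y)$ for all $x,y\in Q$; $(\chi\cdot\rho)(x)=\chi(x)\rho(x)$. A group representation of $G$ is in particular a quandle representation of $Conj(G)$. Irreducible representations are nonzero. *)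

theory Defs
  imports Complex_Main "HOL-Algebra.Generated_Groups"
begin

section \<open>Quandles and their characters\<close>

record 'a qset = "'a partial_object" +
  qop :: "'a \<Rightarrow> 'a \<Rightarrow> 'a" (infixl \<open>\<rhd>\<index>\<close> 70)

locale quandle =
  fixes Q (structure)
  assumes idem: "x \<in> carrier Q \<Longrightarrow> x \<rhd> x = x"
    and bij: "x \<in> carrier Q \<Longrightarrow> bij_betw (\<lambda>y. x \<rhd> y) (carrier Q) (carrier Q)"
    and distrib: "\<lbrakk>x \<in> carrier Q; y \<in> carrier Q; z \<in> carrier Q\<rbrakk>
      \<Longrightarrow> x \<rhd> (y \<rhd> z) = (x \<rhd> y) \<rhd> (x \<rhd> z)"

definition Conj :: "('a, 'm) monoid_scheme \<Rightarrow> 'a qset" where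
  "Conj G = \<lparr>carrier = carrier G, qop = (\<lambda>x y. x \<otimes>\<^bsub>G\<^esub> y \<otimes>\<^bsub>G\<^esub> inv\<^bsub>G\<^esub> x)\<rparr>"

definition quandle_character :: "('a, 'm) qset_scheme \<Rightarrow> ('a \<Rightarrow> complex) \<Rightarrow> bool" where
  "quandle_character Q \<chi> \<longleftrightarrow>
     \<chi> \<in> carrier Q \<rightarrow> - {0} \<and>
     (\<forall>x\<in>carrier Q. \<forall>y\<in>carrier Q. \<chi> (x \<rhd>\<^bsub>Q\<^esub> y) = \<chi> y)"

section \<open>Hermitian spaces, linear and unitary groups\<close>

locale hermitian_space = vector_space scale
  for scale :: "complex \<Rightarrow> 'v::ab_group_add \<Rightarrow> 'v" +
  fixes ip :: "'v \<Rightarrow> 'v \<Rightarrow> complex"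
  assumes finite_dim: "\<exists>B. finite B \<and> span B = UNIV"
    and ip_add_left: "ip (u + v) w = ip u w + ip v w"
    and ip_scale_left: "ip (scale c v) w = c * ip v w"
    and ip_cnj: "ip w v = cnj (ip v w)"
    and ip_pos: "v \<noteq> 0 \<Longrightarrow> Im (ip v v) = 0 \<and> Re (ip v v) > 0"

definition GL :: "(complex \<Rightarrow> 'v::ab_group_add \<Rightarrow> 'v) \<Rightarrow> ('v \<Rightarrow> 'v) monoid" where
  "GL scale = \<lparr>carrier = {f. Vector_Spaces.linear scale scale f \<and> bij f}, mult = (\<circ>), one = id\<rparr>"

definition unitaries ::
  "(complex \<Rightarrow> 'v::ab_group_add \<Rightarrow> 'v) \<Rightarrow> ('v \<Rightarrow> 'v \<Rightarrow> complex) \<Rightarrow> ('v \<Rightarrow> 'v) set" where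
  "unitaries scale ip = {f \<in> carrier (GL scale). \<forall>v w. ip (f v) (f w) = ip v w}"

section \<open>Representations\<close>

definition quandle_rep ::
  "('a, 'm) qset_scheme \<Rightarrow> (complex \<Rightarrow> 'v::ab_group_add \<Rightarrow> 'v) \<Rightarrow> ('a \<Rightarrow> 'v \<Rightarrow> 'v) \<Rightarrow> bool" where
  "quandle_rep Q scale \<rho> \<longleftrightarrow>
     \<rho> \<in> carrier Q \<rightarrow> carrier (GL scale) \<and>
     (\<forall>x\<in>carrier Q. \<forall>y\<in>carrier Q.
        \<rho> (x \<rhd>\<^bsub>Q\<^esub> y) = \<rho> x \<otimes>\<^bsub>GL scale\<^esub> \<rho> y \<otimes>\<^bsub>GL scale\<^esub> inv\<^bsub>GL scale\<^esub> \<rho> x)"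

definition char_mult ::
  "(complex \<Rightarrow> 'v \<Rightarrow> 'v) \<Rightarrow> ('a \<Rightarrow> complex) \<Rightarrow> ('a \<Rightarrow> 'v \<Rightarrow> 'v) \<Rightarrow> 'a \<Rightarrow> 'v \<Rightarrow> 'v" where
  "char_mult scale \<chi> \<rho> = (\<lambda>x v. scale (\<chi> x) (\<rho> x v))"

definition irreducible_group_rep ::
  "('a, 'm) monoid_scheme \<Rightarrow> (complex \<Rightarrow> 'v::ab_group_add \<Rightarrow> 'v) \<Rightarrow> ('a \<Rightarrow> 'v \<Rightarrow> 'v) \<Rightarrow> bool" where
  "irreducible_group_rep G scale \<rho> \<longleftrightarrow>
     \<rho> \<in> hom G (GL scale) \<and>
     (UNIV :: 'v set) \<noteq> {0} \<and>
     (\<forall>W. module.subspace scale W \<and> (\<forall>g\<in>carrier G. \<rho> g ` W \<subseteq> W) \<longrightarrow> W = {0} \<or> W = UNIV)"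

section \<open>Second cohomology with trivial action, Schur covers\<close>

definition complex_units :: "complex monoid" where
  "complex_units = \<lparr>carrier = - {0}, mult = (*), one = 1\<rparr>"

text \<open>Inhomogeneous cochains; functions are extensional, so that equality of cochains is
  equality on the carrier.\<close>

definition cocycles2 ::
  "('h, 'm) monoid_scheme \<Rightarrow> ('b, 'n) monoid_scheme \<Rightarrow> ('h \<times> 'h \<Rightarrow> 'b) monoid" where
  "cocycles2 H A =
     \<lparr>carrier = {f \<in> carrier H \<times> carrier H \<rightarrow>\<^sub>E carrier A.
        \<forall>x\<in>carrier H. \<forall>y\<in>carrier H. \<forall>z\<in>carrier H.
          f (y, z) \<otimes>\<^bsub>A\<^esub> f (x, y \<otimes>\<^bsub>H\<^esub> z) = f (x \<otimes>\<^bsub>H\<^esub> y, z) \<otimes>\<^bsub>A\<^esub> f (x, y)},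
      mult = (\<lambda>f g. \<lambda>p\<in>carrier H \<times> carrier H. f p \<otimes>\<^bsub>A\<^esub> g p),
      one = (\<lambda>p\<in>carrier H \<times> carrier H. \<one>\<^bsub>A\<^esub>)\<rparr>"

definition coboundaries2 ::
  "('h, 'm) monoid_scheme \<Rightarrow> ('b, 'n) monoid_scheme \<Rightarrow> ('h \<times> 'h \<Rightarrow> 'b) set" where
  "coboundaries2 H A =
     (\<lambda>c. \<lambda>(x, y)\<in>carrier H \<times> carrier H. c y \<otimes>\<^bsub>A\<^esub> inv\<^bsub>A\<^esub> c (x \<otimes>\<^bsub>H\<^esub> y) \<otimes>\<^bsub>A\<^esub> c x)
       ` (carrier H \<rightarrow> carrier A)"

definition H2 ::
  "('h, 'm) monoid_scheme \<Rightarrow> ('b, 'n) monoid_scheme \<Rightarrow> ('h \<times> 'h \<Rightarrow> 'b) set monoid" where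
  "H2 H A = cocycles2 H A Mod coboundaries2 H A"

definition center :: "('a, 'm) monoid_scheme \<Rightarrow> 'a set" where
  "center G = {z \<in> carrier G. \<forall>x\<in>carrier G. z \<otimes>\<^bsub>G\<^esub> x = x \<otimes>\<^bsub>G\<^esub> z}"

definition schur_cover :: "('a, 'm) monoid_scheme \<Rightarrow> ('h, 'n) monoid_scheme \<Rightarrow> bool" where
  "schur_cover G H \<longleftrightarrow>
     group G \<and> finite (carrier G) \<and> group H \<and>
     (\<exists>\<theta>\<in>epi G H.
        kernel G H \<theta> \<subseteq> center G \<and>
        kernel G H \<theta> \<subseteq> derived G (carrier G) \<and>
        G\<lparr>carrier := kernel G H \<theta>\<rparr> \<cong> H2 H complex_units)"

section \<open>Well-formedness\<close>

lemma (in group) quandle_Conj: "quandle (Conj G)"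
proof
  have 1: "inv x \<otimes> (x \<otimes> y) = y" "x \<otimes> (inv x \<otimes> y) = y"
    if "x \<in> carrier G" "y \<in> carrier G" for x y
    using that by (simp_all flip: m_assoc)
  fix x assume x: "x \<in> carrier (Conj G)"
  then show "x \<rhd>\<^bsub>Conj G\<^esub> x = x" by (simp add: Conj_def m_assoc)
  show "bij_betw (\<lambda>y. x \<rhd>\<^bsub>Conj G\<^esub> y) (carrier (Conj G)) (carrier (Conj G))"
    using x by (intro bij_betwI[where g = "\<lambda>y. inv x \<otimes> y \<otimes> x"])
      (auto simp: Conj_def m_assoc 1)
next
  have 1: "inv x \<otimes> (x \<otimes> y) = y" "x \<otimes> (inv x \<otimes> y) = y"
    if "x \<in> carrier G" "y \<in> carrier G" for x y
    using that by (simp_all flip: m_assoc)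
  fix x y z assume "x \<in> carrier (Conj G)" "y \<in> carrier (Conj G)" "z \<in> carrier (Conj G)"
  then show "x \<rhd>\<^bsub>Conj G\<^esub> (y \<rhd>\<^bsub>Conj G\<^esub> z)
      = (x \<rhd>\<^bsub>Conj G\<^esub> y) \<rhd>\<^bsub>Conj G\<^esub> (x \<rhd>\<^bsub>Conj G\<^esub> z)"
    by (simp add: Conj_def m_assoc inv_mult_group 1)
qed

lemma group_GL:
  assumes "vector_space scale"
  shows "group (GL scale)"
proof (rule groupI)
  interpret vector_space_pair scale scale
    using assms by (simp add: vector_space_pair_def)
  show "\<one>\<^bsub>GL scale\<^esub> \<in> carrier (GL scale)"
    using vs1.linear_id by (simp add: GL_def)
  fix f assume "f \<in> carrier (GL scale)"
  then have f: "Vector_Spaces.linear scale scale f" "bij f" by (auto simp: GL_def)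
  have "Vector_Spaces.linear scale scale (inv_into UNIV f)"
  proof -
    interpret f: Vector_Spaces.linear scale scale f by (fact f(1))
    have inv: "inv_into UNIV f (f x) = x" "f (inv_into UNIV f x) = x" for x
      using f(2) by (simp_all add: bij_is_inj bij_is_surj surj_f_inv_f)
    have "inv_into UNIV f (x + y) = inv_into UNIV f x + inv_into UNIV f y" for x y
      by (metis f.add inv)
    moreover have "inv_into UNIV f (scale c x) = scale c (inv_into UNIV f x)" for c x
      by (metis f.scale inv)
    ultimately show ?thesis
      using assms by (simp add: Vector_Spaces.linear_iff)
  qed
  with f(2) show "\<exists>g\<in>carrier (GL scale). g \<otimes>\<^bsub>GL scale\<^esub> f = \<one>\<^bsub>GL scale\<^esub>"
    by (intro bexI[of _ "inv_into UNIV f"]) (auto simp: GL_def bij_imp_bij_inv bij_is_inj)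
qed (auto simp: GL_def bij_comp comp_assoc intro: Vector_Spaces.linear_compose)

lemma quandle_rep_char_mult:
  assumes "vector_space scale" "quandle Q" "quandle_rep Q scale \<rho>" "quandle_character Q \<chi>"
  shows "quandle_rep Q scale (char_mult scale \<chi> \<rho>)"
proof -
  interpret vector_space_pair scale scale
    using assms by (simp add: vector_space_pair_def)
  interpret GL: group "GL scale" using assms(1) by (rule group_GL)
  have \<chi>: "\<chi> x \<noteq> 0" if "x \<in> carrier Q" for x
    using assms(4) that by (auto simp: quandle_character_def)
  have \<rho>: "\<rho> x \<in> carrier (GL scale)" if "x \<in> carrier Q" for x
    using assms(3) that by (auto simp: quandle_rep_def)
  have in_GL: "char_mult scale \<chi> \<rho> x \<in> carrier (GL scale)" if x: "x \<in> carrier Q" for x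
  proof -
    have l: "Vector_Spaces.linear scale scale (\<rho> x)" and b: "bij (\<rho> x)"
      using \<rho>[OF x] by (auto simp: GL_def)
    have "bij (scale (\<chi> x))"
      using \<chi>[OF x] by (intro o_bij[of "scale (inverse (\<chi> x))"]) (auto simp: fun_eq_iff)
    then have "bij (scale (\<chi> x) \<circ> \<rho> x)" by (rule bij_comp[OF b])
    moreover have "Vector_Spaces.linear scale scale (\<lambda>v. scale (\<chi> x) (\<rho> x v))"
      using l by (rule linear_compose_scale_right)
    ultimately show ?thesis by (simp add: GL_def char_mult_def comp_def)
  qed
  have "char_mult scale \<chi> \<rho> (x \<rhd>\<^bsub>Q\<^esub> y) = char_mult scale \<chi> \<rho> x \<otimes>\<^bsub>GL scale\<^esub> char_mult scale \<chi> \<rho> y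
      \<otimes>\<^bsub>GL scale\<^esub> inv\<^bsub>GL scale\<^esub> char_mult scale \<chi> \<rho> x"
    if x: "x \<in> carrier Q" and y: "y \<in> carrier Q" for x y
  proof -
    have xy: "x \<rhd>\<^bsub>Q\<^esub> y \<in> carrier Q"
      using quandle.bij[OF assms(2) x] y by (auto simp: bij_betw_def)
    have "\<rho> (x \<rhd>\<^bsub>Q\<^esub> y) = \<rho> x \<otimes>\<^bsub>GL scale\<^esub> \<rho> y \<otimes>\<^bsub>GL scale\<^esub> inv\<^bsub>GL scale\<^esub> \<rho> x"
      using assms(3) x y by (simp add: quandle_rep_def)
    then have "\<rho> (x \<rhd>\<^bsub>Q\<^esub> y) \<otimes>\<^bsub>GL scale\<^esub> \<rho> x = \<rho> x \<otimes>\<^bsub>GL scale\<^esub> \<rho> y"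
      using \<rho> x y by (simp add: GL.m_assoc)
    then have eq: "\<rho> (x \<rhd>\<^bsub>Q\<^esub> y) (\<rho> x v) = \<rho> x (\<rho> y v)" for v
      by (auto simp: GL_def dest: fun_cong)
    have sc: "\<rho> z (scale c v) = scale c (\<rho> z v)" if "z \<in> carrier Q" for z c v
      using \<rho>[OF that] by (auto simp: GL_def linear_scale)
    have "\<chi> (x \<rhd>\<^bsub>Q\<^esub> y) = \<chi> y"
      using assms(4) x y by (simp add: quandle_character_def)
    then have "char_mult scale \<chi> \<rho> (x \<rhd>\<^bsub>Q\<^esub> y) \<otimes>\<^bsub>GL scale\<^esub> char_mult scale \<chi> \<rho> x
        = char_mult scale \<chi> \<rho> x \<otimes>\<^bsub>GL scale\<^esub> char_mult scale \<chi> \<rho> y"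
      using sc x y xy by (auto simp: GL_def char_mult_def fun_eq_iff eq mult.commute)
    then show ?thesis
      using in_GL x y xy by (simp add: GL.inv_solve_right)
  qed
  with in_GL show ?thesis by (auto simp: quandle_rep_def)
qed

lemma (in group) quandle_rep_Conj:
  assumes "vector_space scale" "\<rho> \<in> hom G (GL scale)"
  shows "quandle_rep (Conj G) scale \<rho>"
proof -
  interpret group_hom G "GL scale" \<rho>
    using assms group_GL by (simp add: group_hom_def group_hom_axioms_def is_group)
  show ?thesis by (auto simp: quandle_rep_def Conj_def)
qed

lemma comm_group_complex_units: "comm_group complex_units"
proof (rule comm_groupI)
  fix x assume "x \<in> carrier complex_units"
  then show "\<exists>y\<in>carrier complex_units. y \<otimes>\<^bsub>complex_units\<^esub> x = \<one>\<^bsub>complex_units\<^esub>"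
    by (intro bexI[of _ "inverse x"]) (auto simp: complex_units_def)
qed (auto simp: complex_units_def)

lemma comm_group_H2:
  assumes "group H" "comm_group A"
  shows "comm_group (H2 H A)"
proof -
  interpret H: group H by fact
  interpret A: comm_group A by fact
  note [simp] = cocycles2_def
  have Z: "comm_group (cocycles2 H A)"
  proof (rule comm_groupI)
    fix f g assume f: "f \<in> carrier (cocycles2 H A)" and g: "g \<in> carrier (cocycles2 H A)"
    then have [simp]: "f (x, y) \<in> carrier A" "g (x, y) \<in> carrier A"
      if "x \<in> carrier H" "y \<in> carrier H" for x y
      using that by auto
    have "(f (y, z) \<otimes>\<^bsub>A\<^esub> g (y, z)) \<otimes>\<^bsub>A\<^esub> (f (x, y \<otimes>\<^bsub>H\<^esub> z) \<otimes>\<^bsub>A\<^esub> g (x, y \<otimes>\<^bsub>H\<^esub> z))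
        = (f (x \<otimes>\<^bsub>H\<^esub> y, z) \<otimes>\<^bsub>A\<^esub> g (x \<otimes>\<^bsub>H\<^esub> y, z)) \<otimes>\<^bsub>A\<^esub> (f (x, y) \<otimes>\<^bsub>A\<^esub> g (x, y))"
      if "x \<in> carrier H" "y \<in> carrier H" "z \<in> carrier H" for x y z
    proof -
      have "(f (y, z) \<otimes>\<^bsub>A\<^esub> f (x, y \<otimes>\<^bsub>H\<^esub> z)) \<otimes>\<^bsub>A\<^esub> (g (y, z) \<otimes>\<^bsub>A\<^esub> g (x, y \<otimes>\<^bsub>H\<^esub> z))
          = (f (x \<otimes>\<^bsub>H\<^esub> y, z) \<otimes>\<^bsub>A\<^esub> f (x, y)) \<otimes>\<^bsub>A\<^esub> (g (x \<otimes>\<^bsub>H\<^esub> y, z) \<otimes>\<^bsub>A\<^esub> g (x, y))"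
        using f g that by simp
      then show ?thesis using that by (simp add: A.m_ac)
    qed
    then show "f \<otimes>\<^bsub>cocycles2 H A\<^esub> g \<in> carrier (cocycles2 H A)" by auto
    show "f \<otimes>\<^bsub>cocycles2 H A\<^esub> g = g \<otimes>\<^bsub>cocycles2 H A\<^esub> f"
      by (auto intro!: restrict_ext simp: A.m_comm)
    show "\<one>\<^bsub>cocycles2 H A\<^esub> \<otimes>\<^bsub>cocycles2 H A\<^esub> f = f"
      using f by (intro extensionalityI[of _ "carrier H \<times> carrier H"]) (auto simp: PiE_def)
    have "inv\<^bsub>A\<^esub> f (y, z) \<otimes>\<^bsub>A\<^esub> inv\<^bsub>A\<^esub> f (x, y \<otimes>\<^bsub>H\<^esub> z) = inv\<^bsub>A\<^esub> f (x \<otimes>\<^bsub>H\<^esub> y, z) \<otimes>\<^bsub>A\<^esub> inv\<^bsub>A\<^esub> f (x, y)"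
      if "x \<in> carrier H" "y \<in> carrier H" "z \<in> carrier H" for x y z
      using f that by (simp flip: A.inv_mult)
    then show "\<exists>h\<in>carrier (cocycles2 H A). h \<otimes>\<^bsub>cocycles2 H A\<^esub> f = \<one>\<^bsub>cocycles2 H A\<^esub>"
      by (intro bexI[of _ "\<lambda>p\<in>carrier H \<times> carrier H. inv\<^bsub>A\<^esub> f p"])
        (auto intro!: restrict_ext)
    fix h assume "h \<in> carrier (cocycles2 H A)"
    then have [simp]: "h (x, y) \<in> carrier A" if "x \<in> carrier H" "y \<in> carrier H" for x y
      using that by auto
    show "f \<otimes>\<^bsub>cocycles2 H A\<^esub> g \<otimes>\<^bsub>cocycles2 H A\<^esub> h = f \<otimes>\<^bsub>cocycles2 H A\<^esub> (g \<otimes>\<^bsub>cocycles2 H A\<^esub> h)"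
      by (auto intro!: restrict_ext simp: A.m_assoc)
  qed auto
  interpret Z: comm_group "cocycles2 H A" by (fact Z)
  let ?d = "\<lambda>c. \<lambda>(x, y)\<in>carrier H \<times> carrier H. c y \<otimes>\<^bsub>A\<^esub> inv\<^bsub>A\<^esub> c (x \<otimes>\<^bsub>H\<^esub> y) \<otimes>\<^bsub>A\<^esub> c x"
  have c_in: "c x \<in> carrier A" if "c \<in> carrier H \<rightarrow> carrier A" "x \<in> carrier H" for c x
    using that by auto
  have cancel: "a \<otimes>\<^bsub>A\<^esub> (inv\<^bsub>A\<^esub> a \<otimes>\<^bsub>A\<^esub> b) = b" "inv\<^bsub>A\<^esub> a \<otimes>\<^bsub>A\<^esub> (a \<otimes>\<^bsub>A\<^esub> b) = b"
    if "a \<in> carrier A" "b \<in> carrier A" for a b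
    using that by (simp_all flip: A.m_assoc)
  have d_in: "?d c \<in> carrier (cocycles2 H A)" if c: "c \<in> carrier H \<rightarrow> carrier A" for c
  proof -
    have "(c z \<otimes>\<^bsub>A\<^esub> inv\<^bsub>A\<^esub> c (y \<otimes>\<^bsub>H\<^esub> z) \<otimes>\<^bsub>A\<^esub> c y) \<otimes>\<^bsub>A\<^esub>
          (c (y \<otimes>\<^bsub>H\<^esub> z) \<otimes>\<^bsub>A\<^esub> inv\<^bsub>A\<^esub> c (x \<otimes>\<^bsub>H\<^esub> (y \<otimes>\<^bsub>H\<^esub> z)) \<otimes>\<^bsub>A\<^esub> c x)
        = (c z \<otimes>\<^bsub>A\<^esub> inv\<^bsub>A\<^esub> c (x \<otimes>\<^bsub>H\<^esub> y \<otimes>\<^bsub>H\<^esub> z) \<otimes>\<^bsub>A\<^esub> c (x \<otimes>\<^bsub>H\<^esub> y)) \<otimes>\<^bsub>A\<^esub>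
          (c y \<otimes>\<^bsub>A\<^esub> inv\<^bsub>A\<^esub> c (x \<otimes>\<^bsub>H\<^esub> y) \<otimes>\<^bsub>A\<^esub> c x)"
      if "x \<in> carrier H" "y \<in> carrier H" "z \<in> carrier H" for x y z
    proof -
      have cancel2: "(p \<otimes>\<^bsub>A\<^esub> inv\<^bsub>A\<^esub> a \<otimes>\<^bsub>A\<^esub> q) \<otimes>\<^bsub>A\<^esub> (a \<otimes>\<^bsub>A\<^esub> t \<otimes>\<^bsub>A\<^esub> r) = p \<otimes>\<^bsub>A\<^esub> q \<otimes>\<^bsub>A\<^esub> r \<otimes>\<^bsub>A\<^esub> t"
        if "p \<in> carrier A" "q \<in> carrier A" "r \<in> carrier A" "t \<in> carrier A" "a \<in> carrier A" for p q r t a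
      proof -
        have "(p \<otimes>\<^bsub>A\<^esub> inv\<^bsub>A\<^esub> a \<otimes>\<^bsub>A\<^esub> q) \<otimes>\<^bsub>A\<^esub> (a \<otimes>\<^bsub>A\<^esub> t \<otimes>\<^bsub>A\<^esub> r)
            = a \<otimes>\<^bsub>A\<^esub> (inv\<^bsub>A\<^esub> a \<otimes>\<^bsub>A\<^esub> (p \<otimes>\<^bsub>A\<^esub> q \<otimes>\<^bsub>A\<^esub> r \<otimes>\<^bsub>A\<^esub> t))"
          using that by (simp add: A.m_ac)
        then show ?thesis using that by (simp add: cancel)
      qed
      have cancel3: "(p \<otimes>\<^bsub>A\<^esub> t \<otimes>\<^bsub>A\<^esub> a) \<otimes>\<^bsub>A\<^esub> (q \<otimes>\<^bsub>A\<^esub> inv\<^bsub>A\<^esub> a \<otimes>\<^bsub>A\<^esub> r) = p \<otimes>\<^bsub>A\<^esub> q \<otimes>\<^bsub>A\<^esub> r \<otimes>\<^bsub>A\<^esub> t"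
        if "p \<in> carrier A" "q \<in> carrier A" "r \<in> carrier A" "t \<in> carrier A" "a \<in> carrier A" for p q r t a
      proof -
        have "(p \<otimes>\<^bsub>A\<^esub> t \<otimes>\<^bsub>A\<^esub> a) \<otimes>\<^bsub>A\<^esub> (q \<otimes>\<^bsub>A\<^esub> inv\<^bsub>A\<^esub> a \<otimes>\<^bsub>A\<^esub> r)
            = a \<otimes>\<^bsub>A\<^esub> (inv\<^bsub>A\<^esub> a \<otimes>\<^bsub>A\<^esub> (p \<otimes>\<^bsub>A\<^esub> q \<otimes>\<^bsub>A\<^esub> r \<otimes>\<^bsub>A\<^esub> t))"
          using that by (simp add: A.m_ac)
        then show ?thesis using that by (simp add: cancel)
      qed
      show ?thesis
        using that c_in[OF c] by (simp add: cancel2 cancel3 H.m_assoc)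
    qed
    then show ?thesis using c_in[OF c] by auto
  qed
  have hom: "?d c \<otimes>\<^bsub>cocycles2 H A\<^esub> ?d e = ?d (\<lambda>x. c x \<otimes>\<^bsub>A\<^esub> e x)"
    if "c \<in> carrier H \<rightarrow> carrier A" "e \<in> carrier H \<rightarrow> carrier A" for c e
    using c_in[OF that(1)] c_in[OF that(2)]
    by (auto intro!: restrict_ext simp: A.inv_mult A.m_ac)
  have d_one: "?d (\<lambda>x. \<one>\<^bsub>A\<^esub>) = \<one>\<^bsub>cocycles2 H A\<^esub>"
    by (auto intro!: restrict_ext)
  have "subgroup (coboundaries2 H A) (cocycles2 H A)"
  proof (rule Z.subgroupI)
    show "coboundaries2 H A \<subseteq> carrier (cocycles2 H A)"
      unfolding coboundaries2_def using d_in by blast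
    show "coboundaries2 H A \<noteq> {}"
      unfolding coboundaries2_def by (auto intro!: exI[of _ "\<lambda>_. \<one>\<^bsub>A\<^esub>"])
    fix f assume "f \<in> coboundaries2 H A"
    then obtain c where c: "c \<in> carrier H \<rightarrow> carrier A" and f: "f = ?d c"
      by (auto simp: coboundaries2_def)
    let ?c' = "\<lambda>x. inv\<^bsub>A\<^esub> c x"
    have c': "?c' \<in> carrier H \<rightarrow> carrier A" using c by auto
    have "?d ?c' \<otimes>\<^bsub>cocycles2 H A\<^esub> f = ?d (\<lambda>x. ?c' x \<otimes>\<^bsub>A\<^esub> c x)"
      unfolding f by (rule hom[OF c' c])
    also have "\<dots> = ?d (\<lambda>x. \<one>\<^bsub>A\<^esub>)"
      using c_in[OF c] by (auto intro!: restrict_ext)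
    also note d_one
    finally have "inv\<^bsub>cocycles2 H A\<^esub> f = ?d ?c'"
      by (rule Z.inv_equality) (unfold f, fact d_in[OF c], fact d_in[OF c'])
    then show "inv\<^bsub>cocycles2 H A\<^esub> f \<in> coboundaries2 H A"
      unfolding coboundaries2_def using c' by (rule image_eqI)
    fix g assume "g \<in> coboundaries2 H A"
    then obtain e where e: "e \<in> carrier H \<rightarrow> carrier A" and g: "g = ?d e"
      by (auto simp: coboundaries2_def)
    have "(\<lambda>x. c x \<otimes>\<^bsub>A\<^esub> e x) \<in> carrier H \<rightarrow> carrier A" using c e by auto
    then show "f \<otimes>\<^bsub>cocycles2 H A\<^esub> g \<in> coboundaries2 H A"
      unfolding f g hom[OF c e] coboundaries2_def by (rule image_eqI[OF refl])
  qed
  then show ?thesis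
    unfolding H2_def by (rule Z.abelian_FactGroup)
qed

end

theory Submission
  imports Defs "HOL-Algebra.Multiplicative_Group"
begin

text \<open>
  Twisting by \<open>\<chi>\<close> multiplies the inner products \<open>\<langle>\<rho>' x v, \<rho>' x w\<rangle>\<close> by \<open>\<bar>\<chi> x\<bar>\<^sup>2\<close>. So if
  \<open>\<chi> x \<cdot> \<rho>' x\<close> is unitary, then \<open>\<rho>' x\<close> multiplies inner products by \<open>\<bar>\<chi> x\<bar>\<^sup>-\<^sup>2\<close>, and hence
  \<open>\<rho>' (x\<^sup>n) = (\<rho>' x)\<^sup>n\<close> multiplies them by \<open>(\<bar>\<chi> x\<bar>\<^sup>-\<^sup>2)\<^sup>n\<close> (\<open>hom_similarity_pow\<close>). As \<open>G\<close> is finite,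
  for \<open>n = \<bar>G\<bar>\<close> this operator is the identity of the nonzero space \<open>V\<close>, which forces \<open>\<bar>\<chi> x\<bar> = 1\<close>
  (\<open>similarity_ratio_eq_1\<close>); then \<open>\<rho>' x\<close> itself is unitary. The converse is immediate.
\<close>

context hermitian_space
begin

lemma ip_scale_right: "ip v (scale c w) = cnj c * ip v w"
  by (metis ip_cnj ip_scale_left complex_cnj_mult)

lemma ip_scale_both:
  "ip (scale c v) (scale c w) = complex_of_real ((cmod c)\<^sup>2) * ip v w"
proof -
  have "ip (scale c v) (scale c w) = (c * cnj c) * ip v w"
    by (simp add: ip_scale_left ip_scale_right)
  then show ?thesis
    by (simp only: complex_norm_square)
qed

lemma ip_self_neq_0: "v \<noteq> 0 \<Longrightarrow> ip v v \<noteq> 0"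
  using ip_pos[of v] by auto

text \<open>A hypothesis of the form \<open>c \<cdot> \<langle>T v, T w\<rangle> = \<langle>v, w\<rangle>\<close> says that the operator \<open>T\<close> multiplies
  inner products by \<open>1 / c\<close>; this factor is multiplicative in \<open>T\<close>.\<close>

lemma hom_similarity_pow:
  assumes "group G" "\<rho> \<in> hom G (GL scale)" "x \<in> carrier G"
    and similarity: "\<And>v w. c * ip (\<rho> x v) (\<rho> x w) = ip v w"
  shows "c ^ n * ip (\<rho> (x [^]\<^bsub>G\<^esub> n) v) (\<rho> (x [^]\<^bsub>G\<^esub> n) w) = ip v w"
proof -
  interpret group_hom G "GL scale" \<rho>
    using assms(1,2) group_GL[OF vector_space_axioms]
    by (simp add: group_hom_def group_hom_axioms_def)
  show ?thesis
  proof (induction n arbitrary: v w)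
    case 0
    have "\<rho> \<one>\<^bsub>G\<^esub> = id"
      using hom_one by (simp add: GL_def)
    then show ?case by simp
  next
    case (Suc n)
    have "\<rho> (x [^]\<^bsub>G\<^esub> Suc n) = \<rho> (x [^]\<^bsub>G\<^esub> n) \<circ> \<rho> x"
      using hom_mult[of "x [^]\<^bsub>G\<^esub> n" x] assms(3) by (simp add: GL_def)
    then show ?case
      using Suc.IH[of "\<rho> x v" "\<rho> x w"] similarity by (simp add: mult.assoc)
  qed
qed

lemma similarity_ratio_eq_1:
  assumes "group G" "finite (carrier G)" "\<rho> \<in> hom G (GL scale)" "x \<in> carrier G"
    and v: "(v :: 'v) \<noteq> 0" and "r \<ge> 0"
    and similarity: "\<And>v w. complex_of_real r * ip (\<rho> x v) (\<rho> x w) = ip v w"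
  shows "r = 1"
proof -
  interpret group_hom G "GL scale" \<rho>
    using assms(1,3) group_GL[OF vector_space_axioms]
    by (simp add: group_hom_def group_hom_axioms_def)
  have "\<rho> (x [^]\<^bsub>G\<^esub> order G) = id"
    using hom_one group.pow_order_eq_1[OF assms(1,4)] by (simp add: GL_def)
  with hom_similarity_pow[OF assms(1,3,4) similarity, of "order G" v v]
  have "complex_of_real r ^ order G = 1"
    using ip_self_neq_0[OF v] by simp
  then have "r ^ order G = 1"
    by (metis of_real_eq_1_iff of_real_power)
  moreover have "order G > 0"
    using assms(2) monoid.order_gt_0_iff_finite[OF group.is_monoid[OF assms(1)]] by blast
  ultimately show ?thesis
    using \<open>r \<ge> 0\<close> by (auto dest: power_eq_1_iff)
qed

end

theorem mainTheorem12:
  fixes G :: "('a, 'm) monoid_scheme"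
    and H :: "('h, 'n) monoid_scheme"
    and scale :: "complex \<Rightarrow> 'v::ab_group_add \<Rightarrow> 'v"
    and ip :: "'v \<Rightarrow> 'v \<Rightarrow> complex"
    and \<rho>' :: "'a \<Rightarrow> 'v \<Rightarrow> 'v"
    and \<chi> :: "'a \<Rightarrow> complex"
  assumes "schur_cover G H"
    and "hermitian_space scale ip"
    and "irreducible_group_rep G scale \<rho>'"
    and "quandle_character (Conj G) \<chi>"
  shows "char_mult scale \<chi> \<rho>' \<in> carrier (Conj G) \<rightarrow> unitaries scale ip \<longleftrightarrow>
    \<rho>' \<in> carrier G \<rightarrow> unitaries scale ip \<and> (\<forall>x\<in>carrier G. cmod (\<chi> x) = 1)"
    (is "?twist \<longleftrightarrow> ?untwist")
proof -
  interpret hermitian_space scale ip by fact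
  have G: "group G" and fin: "finite (carrier G)"
    using assms(1) by (auto simp: schur_cover_def)
  have hom: "\<rho>' \<in> hom G (GL scale)" and "(UNIV :: 'v set) \<noteq> {0}"
    using assms(3) by (auto simp: irreducible_group_rep_def)
  then obtain u :: 'v where u: "u \<noteq> 0"
    by auto
  have carrier_Conj: "carrier (Conj G) = carrier G"
    by (simp add: Conj_def)
  have GL: "\<rho>' x \<in> carrier (GL scale)" if "x \<in> carrier G" for x
    using hom that by (auto simp: hom_def)
  have twist_GL: "char_mult scale \<chi> \<rho>' x \<in> carrier (GL scale)" if "x \<in> carrier G" for x
    using quandle_rep_char_mult[OF vector_space_axioms group.quandle_Conj[OF G]
        group.quandle_rep_Conj[OF G vector_space_axioms hom] assms(4)] that
    by (auto simp: quandle_rep_def carrier_Conj)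
  have twist_ip: "ip (char_mult scale \<chi> \<rho>' x v) (char_mult scale \<chi> \<rho>' x w)
      = complex_of_real ((cmod (\<chi> x))\<^sup>2) * ip (\<rho>' x v) (\<rho>' x w)" for x v w
    unfolding char_mult_def by (rule ip_scale_both)
  show ?thesis
  proof
    assume twist: ?twist
    have similarity: "complex_of_real ((cmod (\<chi> x))\<^sup>2) * ip (\<rho>' x v) (\<rho>' x w) = ip v w"
      if "x \<in> carrier G" for x v w
    proof -
      have "char_mult scale \<chi> \<rho>' x \<in> unitaries scale ip"
        using twist that by (auto simp: carrier_Conj)
      then show ?thesis
        unfolding twist_ip[symmetric] by (simp add: unitaries_def)
    qed
    have sq: "(cmod (\<chi> x))\<^sup>2 = 1" if "x \<in> carrier G" for x
      using similarity_ratio_eq_1[OF G fin hom that u _ similarity[OF that]] by simp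
    have "\<forall>x\<in>carrier G. cmod (\<chi> x) = 1"
      using power_eq_1_iff[OF sq] by simp
    moreover have "\<rho>' \<in> carrier G \<rightarrow> unitaries scale ip"
      using similarity GL by (auto simp: unitaries_def sq)
    ultimately show ?untwist by blast
  next
    assume untwist: ?untwist
    then have "ip (\<rho>' x v) (\<rho>' x w) = ip v w" if "x \<in> carrier G" for x v w
      using that by (simp add: unitaries_def Pi_iff)
    with untwist show ?twist
      using twist_GL by (auto simp: unitaries_def twist_ip carrier_Conj)
  qed
qed

end
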